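(* Let $\mathcal{C}$ be the set of all integer, symmetric, connected, positive definite matrices (of all orders $n\in\mathbb{N}$). Then: (1) the set $\{\overline{Tr}(A): A\in\mathcal{C}\}$ is dense in $[2,\infty)$; (2) the set $\{\overline{Tr_2}(A): A\in\mathcal{C}\}$ is dense in $[6,\infty)$. Here a set $X\subset\mathbb{R}$ is said to be dense in an interval $I$ if every point of $I$ lies in the closure of $X$.
   Context: For a real $n\times n$ matrix $A$ with eigenvalues $\beta_1,\dots,\beta_n$ (with multiplicity), the absolute trace-$k$ measure is $\overline{Tr_k}(A)=\frac1n\sum_{i=1}^n\beta_i^k$, and $\overline{Tr}(A)=\overline{Tr_1}(A)$ is the absolute trace. A symmetric $n\times n$ matrix $A=(a_{ij})$ is connected if the graph on vertices $1,\dots,n$ with an edge between $i\neq j$ whenever $a_{ij}\neq0$ is connected; equivalently, no simultaneous permutation of the rows and columns of $A$ brings it to block diagonal form with more than one block. *)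

theory Defs
  imports
    "Jordan_Normal_Form.Char_Poly"
    "Graph_Theory.Digraph_Component"
    "HOL-Analysis.Elementary_Topology"
begin

definition eigenvalues_mset :: "real mat \<Rightarrow> complex multiset" where
  "eigenvalues_mset A = proots (char_poly (map_mat complex_of_real A))"

text \<open>
  The power sum of the eigenvalues is taken over the complex numbers. For a square real matrix it
  is a real number (lemma \<open>sum_eigenvalues_power_real\<close> below), so taking the real part only
  changes its type.
\<close>

definition abs_trace_power :: "nat \<Rightarrow> real mat \<Rightarrow> real" where
  "abs_trace_power k A = Re (\<Sum>\<beta>\<in>#eigenvalues_mset A. \<beta> ^ k) / real (dim_row A)"

definition abs_trace :: "real mat \<Rightarrow> real" where
  "abs_trace A = abs_trace_power 1 A"

lemma size_eigenvalues_mset: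
  assumes "A \<in> carrier_mat n n"
  shows "size (eigenvalues_mset A) = n"
  using degree_monic_char_poly[of "map_mat complex_of_real A" n] assms
  by (simp add: eigenvalues_mset_def size_proots_complex)

lemma sum_eigenvalues_power_real:
  assumes A: "A \<in> carrier_mat n n"
  shows "(\<Sum>\<beta>\<in>#eigenvalues_mset A. \<beta> ^ k) \<in> \<real>"
proof -
  define p where "p = char_poly (map_mat complex_of_real A)"
  have p0: "p \<noteq> 0"
    using degree_monic_char_poly[of "map_mat complex_of_real A" n] A by (auto simp: p_def)
  interpret cnj: comm_ring_hom cnj
    by unfold_locales auto
  interpret map_poly_inj_idom_divide_hom cnj
    by unfold_locales auto
  have "map_poly cnj p = char_poly (map_mat cnj (map_mat complex_of_real A))"
    unfolding p_def by (rule cnj.char_poly_hom[symmetric, of _ n]) (use A in auto)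
  also have "map_mat cnj (map_mat complex_of_real A) = map_mat complex_of_real A"
    by (rule eq_matI) auto
  finally have p: "map_poly cnj p = p" by (simp add: p_def)
  have ord: "order (cnj z) p = order z p" for z
    using order_hom[of z p] p by simp
  have "image_mset cnj (proots p) = proots p"
  proof (rule multiset_eqI)
    fix z
    have "count (image_mset cnj M) z = count M (cnj z)" for M
      by (induction M) auto
    then show "count (image_mset cnj (proots p)) z = count (proots p) z"
      using p0 ord by simp
  qed
  moreover have "cnj (\<Sum>\<beta>\<in>#M. \<beta> ^ k) = (\<Sum>\<beta>\<in>#image_mset cnj M. \<beta> ^ k)" for M
    by (induction M) auto
  ultimately have "cnj (\<Sum>\<beta>\<in>#proots p. \<beta> ^ k) = (\<Sum>\<beta>\<in>#proots p. \<beta> ^ k)" by simp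
  then show ?thesis
    by (simp add: eigenvalues_mset_def p_def Reals_cnj_iff)
qed

definition integer_mat :: "real mat \<Rightarrow> bool" where
  "integer_mat A \<longleftrightarrow> elements_mat A \<subseteq> \<int>"

definition pos_def_mat :: "real mat \<Rightarrow> bool" where
  "pos_def_mat A \<longleftrightarrow>
     (\<forall>v \<in> carrier_vec (dim_row A). v \<noteq> 0\<^sub>v (dim_row A) \<longrightarrow> v \<bullet> (A *\<^sub>v v) > 0)"

text \<open>
  For symmetric \<open>A\<close> every edge of the graph occurs with both orientations. The library's
  \<open>connected\<close> requires a nonempty vertex set; its name is qualified because topology has its
  own \<open>connected\<close>.
\<close>

definition mat_graph :: "real mat \<Rightarrow> nat pair_pre_digraph" where
  "mat_graph A = \<lparr> pverts = {..<dim_row A},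
     parcs = {(i, j). i < dim_row A \<and> j < dim_row A \<and> i \<noteq> j \<and> A $$ (i, j) \<noteq> 0} \<rparr>"

definition connected_mat :: "real mat \<Rightarrow> bool" where
  "connected_mat A \<longleftrightarrow> Digraph_Component.connected (with_proj (mat_graph A))"

definition int_sym_conn_pd_mats :: "real mat set" where
  "int_sym_conn_pd_mats =
     {A. \<exists>n\<ge>1. A \<in> carrier_mat n n \<and> integer_mat A \<and> A\<^sup>T = A \<and> connected_mat A \<and> pos_def_mat A}"

definition dense_in_interval :: "real set \<Rightarrow> real set \<Rightarrow> bool" where
  "dense_in_interval X I \<longleftrightarrow> (\<forall>x\<in>I. x \<in> closure X)"

end

theory Submission
  imports Defs "Jordan_Normal_Form.Schur_Decomposition" "HOL-Analysis.Elementary_Metric_Spaces"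
begin

text \<open>
  The power sum of the eigenvalues of \<open>A\<close> is the trace of a power of \<open>A\<close> (lemma
  \<open>abs_trace_power_eq_mat_trace\<close>), so both quantities can be read off from the entries: up to the
  factor \<open>1/n\<close>, the first one is the sum of the diagonal entries and the second one, for symmetric
  \<open>A\<close>, the sum of the squares of all entries. It remains to find enough matrices in the class,
  and it suffices to take those whose graph is a path, with all entries \<open>1\<close> on the edges
  and integers \<open>d\<^sub>i \<ge> 2\<close> on the diagonal. Such a matrix is positive definite, because its
  quadratic form dominates
  \<open>v\<^sub>0\<^sup>2 + (v\<^sub>0 + v\<^sub>1)\<^sup>2 + \<dots> + (v\<^sub>m\<^sub>-\<^sub>1 + v\<^sub>m)\<^sup>2 + v\<^sub>m\<^sup>2\<close>, the form of the case in which all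
  \<open>d\<^sub>i\<close> are equal to \<open>2\<close> (lemma \<open>path_quadratic_form_ge\<close>).

  The diagonal can therefore be raised freely. If \<open>k\<close> of the \<open>n\<close> diagonal entries are \<open>t\<close> and the
  others are \<open>2\<close>, the two averages are \<open>2 + (k/n) (t - 2)\<close> and \<open>6 + (k/n) (t\<^sup>2 - 4) - 2/n\<close>. For
  fixed \<open>t\<close> and growing \<open>n\<close> the fractions \<open>k/n\<close> fill the interval from \<open>0\<close> to \<open>1\<close>, so the values
  accumulate at every point from \<open>2\<close> to \<open>t\<close>, respectively from \<open>6\<close> to \<open>t\<^sup>2 + 2\<close> (lemma
  \<open>mem_closure_if_contains_fractions\<close>); and \<open>t\<close> is arbitrarily large.
\<close>

section \<open>Power sums of eigenvalues as traces\<close>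

definition mat_trace :: "'a :: comm_monoid_add mat \<Rightarrow> 'a" where
  "mat_trace A = (\<Sum>i<dim_row A. A $$ (i, i))"

lemma mat_trace_mult_swap:
  fixes A B :: "'a :: comm_semiring_0 mat"
  assumes "A \<in> carrier_mat n m" "B \<in> carrier_mat m n"
  shows "mat_trace (A * B) = mat_trace (B * A)"
proof -
  have "mat_trace (A * B) = (\<Sum>i<n. \<Sum>j<m. A $$ (i, j) * B $$ (j, i))"
    using assms by (auto simp: mat_trace_def scalar_prod_def lessThan_atLeast0 intro!: sum.cong)
  also have "\<dots> = (\<Sum>j<m. \<Sum>i<n. B $$ (j, i) * A $$ (i, j))"
    by (subst sum.swap) (simp add: mult.commute)
  also have "\<dots> = mat_trace (B * A)"
    using assms by (auto simp: mat_trace_def scalar_prod_def lessThan_atLeast0 intro!: sum.cong)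
  finally show ?thesis .
qed

lemma mat_trace_similar:
  fixes A B :: "'a :: comm_ring_1 mat"
  assumes "similar_mat_wit A B P Q"
  shows "mat_trace A = mat_trace B"
proof -
  define n where "n = dim_row A"
  note w = similar_mat_witD[OF n_def assms]
  have "mat_trace A = mat_trace (P * (B * Q))"
    using w by (simp add: assoc_mult_mat[of _ n n _ n _ n])
  also have "\<dots> = mat_trace ((B * Q) * P)"
    by (rule mat_trace_mult_swap) (use w in auto)
  also have "(B * Q) * P = B"
    using w by (simp add: assoc_mult_mat[of _ n n _ n _ n])
  finally show ?thesis .
qed

lemma upper_triangular_pow_mat:
  fixes B :: "'a :: comm_semiring_1 mat"
  assumes B: "B \<in> carrier_mat n n" and "upper_triangular B"
  shows "upper_triangular (B ^\<^sub>m k) \<and> (\<forall>i<n. (B ^\<^sub>m k) $$ (i, i) = (B $$ (i, i)) ^ k)"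
proof (induction k)
  case 0
  then show ?case using B by (auto simp: upper_triangular_def)
next
  case (Suc k)
  have C: "B ^\<^sub>m k \<in> carrier_mat n n" using B by simp
  have entry: "(B ^\<^sub>m Suc k) $$ (i, j) = (\<Sum>l<n. (B ^\<^sub>m k) $$ (i, l) * B $$ (l, j))"
    if "i < n" "j < n" for i j
    using that B C by (simp add: scalar_prod_def lessThan_atLeast0)
  have zero: "(B ^\<^sub>m k) $$ (i, l) * B $$ (l, j) = 0" if "i < n" "l < n" "l < i \<or> j < l" for i j l
    using that Suc.IH assms C by (auto simp: upper_triangular_def)
  have "(B ^\<^sub>m Suc k) $$ (i, j) = 0" if "i < n" "j < i" for i j
  proof -
    have "(B ^\<^sub>m k) $$ (i, l) * B $$ (l, j) = 0" if "l < n" for l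
      using that \<open>i < n\<close> \<open>j < i\<close> by (cases "l < i") (auto intro!: zero)
    then show ?thesis using that by (subst entry) auto
  qed
  moreover have "(B ^\<^sub>m Suc k) $$ (i, i) = (B $$ (i, i)) ^ Suc k" if "i < n" for i
  proof -
    have "(\<Sum>l<n. (B ^\<^sub>m k) $$ (i, l) * B $$ (l, i))
        = (\<Sum>l\<in>{i}. (B ^\<^sub>m k) $$ (i, l) * B $$ (l, i))"
      by (rule sum.mono_neutral_right) (use that in \<open>auto intro!: zero\<close>)
    then show ?thesis using that Suc.IH by (subst entry) (auto simp: mult.commute)
  qed
  ultimately show ?case using B by (auto simp: upper_triangular_def)
qed

text \<open>
  Both sides are invariant under similarity, so \<open>A\<close> may be replaced by a triangular form, where
  the eigenvalues are the diagonal entries and powers act on the diagonal entrywise.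
\<close>

lemma sum_proots_char_poly_power:
  fixes A :: "complex mat"
  assumes A: "A \<in> carrier_mat n n"
  shows "(\<Sum>\<beta>\<in>#proots (char_poly A). \<beta> ^ k) = mat_trace (A ^\<^sub>m k)"
proof -
  obtain as where "char_poly A = (\<Prod>a\<leftarrow>as. [:- a, 1:])"
    using char_poly_factorized[OF A] by blast
  from schur_decomposition_exists[OF A this] obtain B
    where B: "B \<in> carrier_mat n n" and ut: "upper_triangular B" and sim: "similar_mat A B" by blast
  from sim obtain P Q where wit: "similar_mat_wit A B P Q" unfolding similar_mat_def by blast
  have "mset xs = proots (\<Prod>a\<leftarrow>xs. [:- a, 1:])" for xs :: "complex list"
  proof (induction xs)
    case (Cons a xs)
    have "(\<Prod>a\<leftarrow>xs. [:- a, 1:]) \<noteq> 0" by (auto simp: prod_list_zero_iff)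
    then show ?case using Cons.IH by (simp add: proots_mult del: mult_pCons_left)
  qed simp
  then have "mset (diag_mat B) = proots (\<Prod>a\<leftarrow>diag_mat B. [:- a, 1:])" .
  also have "\<dots> = proots (char_poly A)"
    using char_poly_similar[OF sim] char_poly_upper_triangular[OF B ut] by simp
  finally have "(\<Sum>\<beta>\<in>#proots (char_poly A). \<beta> ^ k) = (\<Sum>\<beta>\<in>#mset (diag_mat B). \<beta> ^ k)" by simp
  also have "\<dots> = (\<Sum>\<beta>\<leftarrow>diag_mat B. \<beta> ^ k)"
    by (metis mset_map sum_mset_sum_list)
  also have "\<dots> = (\<Sum>i<n. (B $$ (i, i)) ^ k)"
    using B by (simp add: diag_mat_def comp_def interv_sum_list_conv_sum_set_nat lessThan_atLeast0)
  also have "\<dots> = mat_trace (B ^\<^sub>m k)"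
    using upper_triangular_pow_mat[OF B ut, of k] B by (simp add: mat_trace_def)
  also have "\<dots> = mat_trace (A ^\<^sub>m k)"
    using mat_trace_similar[OF similar_mat_wit_pow[OF wit]] by simp
  finally show ?thesis .
qed

lemma abs_trace_power_eq_mat_trace:
  assumes A: "A \<in> carrier_mat n n"
  shows "abs_trace_power k A = mat_trace (A ^\<^sub>m k) / real n"
proof -
  have "(\<Sum>\<beta>\<in>#eigenvalues_mset A. \<beta> ^ k) = mat_trace (map_mat complex_of_real A ^\<^sub>m k)"
    unfolding eigenvalues_mset_def by (rule sum_proots_char_poly_power) (use A in auto)
  also have "\<dots> = mat_trace (map_mat complex_of_real (A ^\<^sub>m k))"
    by (simp add: of_real_hom.mat_hom_pow[OF A])
  also have "\<dots> = complex_of_real (mat_trace (A ^\<^sub>m k))"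
    using A by (simp add: mat_trace_def)
  finally show ?thesis using A by (simp add: abs_trace_power_def)
qed

section \<open>Path matrices\<close>

definition path_mat :: "nat \<Rightarrow> (nat \<Rightarrow> real) \<Rightarrow> real mat" where
  "path_mat n d =
     mat n n (\<lambda>(i, j). if i = j then d i else if i = Suc j \<or> j = Suc i then 1 else 0)"

lemma path_mat_carrier [simp]: "path_mat n d \<in> carrier_mat n n"
  by (simp add: path_mat_def)

lemma dim_path_mat [simp]: "dim_row (path_mat n d) = n" "dim_col (path_mat n d) = n"
  by (simp_all add: path_mat_def)

lemma path_mat_index:
  "i < n \<Longrightarrow> j < n \<Longrightarrow>
     path_mat n d $$ (i, j) = (if i = j then d i else if i = Suc j \<or> j = Suc i then 1 else 0)"
  by (simp add: path_mat_def)

text \<open>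
  Both the quadratic form of a path matrix and the trace of its square are sums of this shape.
\<close>

lemma tridiagonal_double_sum:
  fixes f :: "nat \<Rightarrow> nat \<Rightarrow> 'a :: comm_monoid_add"
  assumes "\<And>i j. i \<noteq> j \<Longrightarrow> i \<noteq> Suc j \<Longrightarrow> j \<noteq> Suc i \<Longrightarrow> f i j = 0"
  shows "(\<Sum>i<Suc m. \<Sum>j<Suc m. f i j)
       = (\<Sum>i<Suc m. f i i) + (\<Sum>i<m. f i (Suc i) + f (Suc i) i)"
proof (induction m)
  case 0
  then show ?case by simp
next
  case (Suc m)
  have row: "(\<Sum>j<m. f (Suc m) j) = 0" and col: "(\<Sum>i<m. f i (Suc m)) = 0"
    by (auto intro!: sum.neutral assms)
  have "(\<Sum>i<Suc (Suc m). \<Sum>j<Suc (Suc m). f i j)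
      = (\<Sum>i<Suc m. \<Sum>j<Suc m. f i j) + (\<Sum>i<Suc m. f i (Suc m)) + (\<Sum>j<Suc m. f (Suc m) j)
        + f (Suc m) (Suc m)"
    by (simp only: sum.lessThan_Suc[of _ "Suc m"] sum.distrib ac_simps)
  also have "\<dots> = (\<Sum>i<Suc m. f i i) + (\<Sum>i<m. f i (Suc i) + f (Suc i) i)
        + (f m (Suc m) + f (Suc m) m) + f (Suc m) (Suc m)"
    unfolding Suc.IH using row col by (simp add: ac_simps)
  also have "\<dots> = (\<Sum>i<Suc (Suc m). f i i) + (\<Sum>i<Suc m. f i (Suc i) + f (Suc i) i)"
    by (simp add: ac_simps)
  finally show ?case .
qed

lemma path_mat_trace: "mat_trace (path_mat n d) = (\<Sum>i<n. d i)"
  by (simp add: mat_trace_def path_mat_index)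

lemma path_mat_trace_square:
  "mat_trace (path_mat (Suc m) d * path_mat (Suc m) d) = (\<Sum>i<Suc m. (d i)\<^sup>2) + 2 * real m"
proof -
  define a where "a i j = (if i = j then d i else if i = Suc j \<or> j = Suc i then 1 else 0)" for i j
  have "mat_trace (path_mat (Suc m) d * path_mat (Suc m) d)
      = (\<Sum>i<Suc m. \<Sum>j<Suc m. a i j * a j i)"
    unfolding mat_trace_def
    by (auto simp: scalar_prod_def path_mat_index a_def lessThan_atLeast0
             simp del: sum.op_ivl_Suc intro!: sum.cong)
  also have "\<dots> = (\<Sum>i<Suc m. a i i * a i i) + (\<Sum>i<m. a i (Suc i) * a (Suc i) i + a (Suc i) i * a i (Suc i))"
    by (rule tridiagonal_double_sum) (auto simp: a_def)
  also have "\<dots> = (\<Sum>i<Suc m. (d i)\<^sup>2) + 2 * real m"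
    by (simp add: a_def power2_eq_square)
  finally show ?thesis .
qed

text \<open>
  Each vertex has \<open>2 v\<^sub>i\<^sup>2\<close> to spend and every edge at it takes one \<open>v\<^sub>i\<^sup>2\<close> to complete
  \<open>2 v\<^sub>i v\<^sub>i\<^sub>+\<^sub>1\<close> to a square. The end vertices lie on only one edge, which leaves the two outer
  terms; without them the alternating vector would make the bound vanish.
\<close>

lemma path_quadratic_form_ge:
  fixes d :: "nat \<Rightarrow> real"
  assumes d: "\<And>i. i < Suc m \<Longrightarrow> d i \<ge> 2" and v: "v \<in> carrier_vec (Suc m)"
  shows "v \<bullet> (path_mat (Suc m) d *\<^sub>v v)
       \<ge> (v $ 0)\<^sup>2 + (\<Sum>i<m. (v $ i + v $ Suc i)\<^sup>2) + (v $ m)\<^sup>2"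
proof -
  define f where "f i j = (if i = j then d i else if i = Suc j \<or> j = Suc i then 1 else 0)
      * v $ i * v $ j" for i j
  have ends: "(v $ 0)\<^sup>2 + (\<Sum>i<l. (v $ i + v $ Suc i)\<^sup>2) + (v $ l)\<^sup>2
      = (\<Sum>i<Suc l. 2 * (v $ i)\<^sup>2) + (\<Sum>i<l. 2 * v $ i * v $ Suc i)" for l
    by (induction l) (auto simp: power2_eq_square algebra_simps)
  have "v \<bullet> (path_mat (Suc m) d *\<^sub>v v) = (\<Sum>i<Suc m. \<Sum>j<Suc m. f i j)"
    using v by (auto simp: scalar_prod_def path_mat_index f_def lessThan_atLeast0 sum_distrib_left
             mult.assoc simp del: sum.op_ivl_Suc intro!: sum.cong)
  also have "\<dots> = (\<Sum>i<Suc m. f i i) + (\<Sum>i<m. f i (Suc i) + f (Suc i) i)"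
    by (rule tridiagonal_double_sum) (auto simp: f_def)
  also have "(\<Sum>i<m. f i (Suc i) + f (Suc i) i) = (\<Sum>i<m. 2 * v $ i * v $ Suc i)"
    by (auto simp: f_def intro!: sum.cong)
  finally have "v \<bullet> (path_mat (Suc m) d *\<^sub>v v)
      = (\<Sum>i<Suc m. f i i) + (\<Sum>i<m. 2 * v $ i * v $ Suc i)" .
  moreover have "(\<Sum>i<Suc m. 2 * (v $ i)\<^sup>2) \<le> (\<Sum>i<Suc m. f i i)"
    using d by (intro sum_mono) (auto simp: f_def power2_eq_square mult.assoc intro!: mult_right_mono)
  ultimately show ?thesis unfolding ends by linarith
qed

lemma path_mat_pos_def:
  assumes d: "\<And>i. i < n \<Longrightarrow> d i \<ge> 2"
  shows "pos_def_mat (path_mat n d)"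
  unfolding pos_def_mat_def
proof (intro ballI impI)
  fix v :: "real vec"
  assume v: "v \<in> carrier_vec (dim_row (path_mat n d))"
    and nz: "v \<noteq> 0\<^sub>v (dim_row (path_mat n d))"
  obtain m where m: "n = Suc m" using v nz by (cases n) auto
  have v': "v \<in> carrier_vec (Suc m)" using v m by simp
  have ge: "(v $ 0)\<^sup>2 + (\<Sum>i<m. (v $ i + v $ Suc i)\<^sup>2) + (v $ m)\<^sup>2
      \<le> v \<bullet> (path_mat n d *\<^sub>v v)"
    unfolding m by (rule path_quadratic_form_ge) (use d m v' in auto)
  show "v \<bullet> (path_mat n d *\<^sub>v v) > 0"
  proof (rule ccontr)
    assume "\<not> ?thesis"
    with ge have le: "(v $ 0)\<^sup>2 + (\<Sum>i<m. (v $ i + v $ Suc i)\<^sup>2) + (v $ m)\<^sup>2 \<le> 0" by linarith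
    have nn: "(\<Sum>i<m. (v $ i + v $ Suc i)\<^sup>2) \<ge> 0" by (rule sum_nonneg) simp
    have v0: "v $ 0 = 0" and "(\<Sum>i<m. (v $ i + v $ Suc i)\<^sup>2) = 0"
      using le nn zero_le_power2[of "v $ 0"] zero_le_power2[of "v $ m"] by (smt (verit) zero_eq_power2)+
    then have step: "v $ i + v $ Suc i = 0" if "i < m" for i
      using that by (subst (asm) sum_nonneg_eq_0_iff) auto
    \<comment> \<open>The vanishing squares carry the value \<open>0\<close> along the path from its first vertex.\<close>
    have "v $ i = 0" if "i < n" for i
      using that
    proof (induction i)
      case (Suc i)
      then show ?case using step[of i] m by simp
    qed (rule v0)
    then show False using nz v by auto
  qed
qed

lemma path_mat_connected:
  assumes "n > 0"
  shows "connected_mat (path_mat n d)"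
proof -
  let ?G = "with_proj (mat_graph (path_mat n d))"
  let ?S = "mk_symmetric ?G"
  interpret G: wf_digraph ?G by unfold_locales (auto simp: mat_graph_def)
  interpret S: pair_wf_digraph ?S by (rule G.wellformed_mk_symmetric)
  have sym: "u \<rightarrow>\<^sup>*\<^bsub>?S\<^esub> v \<Longrightarrow> v \<rightarrow>\<^sup>*\<^bsub>?S\<^esub> u" for u v
    by (rule symmetric_reachable[OF symmetric_mk_symmetric])
  have edge: "(i, Suc i) \<in> parcs ?S" if "Suc i < n" for i
    using that by (force simp: parcs_mk_symmetric mat_graph_def path_mat_index)
  have reach: "0 \<rightarrow>\<^sup>*\<^bsub>?S\<^esub> i" if "i < n" for i
    using that
  proof (induction i)
    case 0
    then show ?case by (intro S.reachable_refl) (simp add: mat_graph_def)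
  next
    case (Suc i)
    then have "0 \<rightarrow>\<^sup>*\<^bsub>?S\<^esub> i" "(i, Suc i) \<in> parcs ?S" using edge by auto
    then show ?case by (rule S.reachable_adj_trans)
  qed
  show ?thesis
    unfolding connected_mat_def
  proof (rule G.connectedI)
    show "verts ?G \<noteq> {}" using assms by (auto simp: mat_graph_def)
  next
    fix u v assume "u \<in> verts ?G" "v \<in> verts ?G"
    then have "u < n" "v < n" by (simp_all add: mat_graph_def)
    then show "u \<rightarrow>\<^sup>*\<^bsub>?S\<^esub> v" using S.reachable_trans[OF sym[OF reach] reach] by blast
  qed
qed

lemma path_mat_in_int_sym_conn_pd_mats:
  assumes "n > 0" and "\<And>i. i < n \<Longrightarrow> d i \<in> \<int>" and "\<And>i. i < n \<Longrightarrow> d i \<ge> 2"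
  shows "path_mat n d \<in> int_sym_conn_pd_mats"
proof -
  have "integer_mat (path_mat n d)"
    using assms(2) by (auto simp: integer_mat_def elements_mat_def path_mat_index)
  moreover have "(path_mat n d)\<^sup>T = path_mat n d"
    by (rule eq_matI) (auto simp: path_mat_index)
  ultimately show ?thesis
    unfolding int_sym_conn_pd_mats_def
    using path_mat_connected[OF assms(1)] path_mat_pos_def[OF assms(3)] assms(1)
    by (auto intro!: exI[of _ n])
qed

lemma abs_trace_path_mat: "abs_trace (path_mat n d) = (\<Sum>i<n. d i) / real n"
  by (simp add: abs_trace_def abs_trace_power_eq_mat_trace[OF path_mat_carrier] path_mat_trace)

lemma abs_trace_power_2_path_mat:
  assumes "n > 0"
  shows "abs_trace_power 2 (path_mat n d) = ((\<Sum>i<n. (d i)\<^sup>2) + 2 * (real n - 1)) / real n"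
proof -
  obtain m where m: "n = Suc m" using assms by (cases n) auto
  have "path_mat n d ^\<^sub>m 2 = path_mat n d * path_mat n d"
    by (simp add: numeral_2_eq_2)
  then show ?thesis
    unfolding abs_trace_power_eq_mat_trace[OF path_mat_carrier] m
    by (simp only: path_mat_trace_square) simp
qed

section \<open>Density\<close>

lemma sum_two_valued:
  fixes a b :: real
  assumes "k \<le> n"
  shows "(\<Sum>i<n. if i < k then a else b) = real n * b + real k * (a - b)"
proof -
  have "(\<Sum>i<n. if i < k then a else b)
      = (\<Sum>i<n. b) + (\<Sum>i<n. if i < k then a - b else 0)"
    unfolding sum.distrib[symmetric] by (rule sum.cong) auto
  also have "(\<Sum>i<n. if i < k then a - b else 0) = (\<Sum>i<k. a - b)"
    by (rule sum.mono_neutral_cong_right) (use assms in auto)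
  finally show ?thesis by simp
qed

text \<open>
  Rounding \<open>n (x - a) / b\<close> down to an integer \<open>k\<close> costs at most \<open>b / n\<close>, and the correction
  \<open>c / n\<close> is of the same order. The correction is there for the second trace, where a path with
  \<open>n\<close> vertices has only \<open>n - 1\<close> edges.
\<close>

lemma mem_closure_if_contains_fractions:
  fixes X :: "real set"
  assumes X: "\<And>n k. n > 0 \<Longrightarrow> k \<le> n \<Longrightarrow> a + real k / real n * b - c / real n \<in> X"
    and x: "a \<le> x" "x \<le> a + b" and b: "b > 0"
  shows "x \<in> closure X"
  unfolding closure_approachable
proof (intro allI impI)
  fix e :: real assume e: "e > 0"
  obtain n where n: "real n > (b + \<bar>c\<bar>) / e" using reals_Archimedean2 by blast
  have "(b + \<bar>c\<bar>) / e > 0" using b e by (intro divide_pos_pos) auto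
  with n have n0: "n > 0" by (cases n) auto
  define y where "y = (x - a) / b"
  have y: "0 \<le> y" "y \<le> 1" using x b by (auto simp: y_def field_simps)
  define k where "k = nat \<lfloor>real n * y\<rfloor>"
  have k: "real k \<le> real n * y" "real n * y < real k + 1"
    using y by (simp_all add: k_def)
  have "real n * y \<le> real n" using y by (simp add: mult_left_le)
  with k have "k \<le> n" by linarith
  let ?z = "a + real k / real n * b - c / real n"
  have "?z - x = ((real k - real n * y) * b - c) / real n"
    using n0 b by (simp add: y_def field_simps)
  moreover have "\<bar>(real k - real n * y) * b\<bar> \<le> 1 * b"
    using k b unfolding abs_mult by (intro mult_mono) auto
  then have "\<bar>(real k - real n * y) * b - c\<bar> \<le> b + \<bar>c\<bar>" by linarith
  ultimately have "dist ?z x \<le> (b + \<bar>c\<bar>) / real n"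
    using n0 by (simp add: dist_real_def divide_right_mono)
  also have "\<dots> < e" using n n0 e by (simp add: field_simps)
  finally show "\<exists>z\<in>X. dist z x < e" using X[OF n0 \<open>k \<le> n\<close>] by blast
qed

theorem theorem3:
  shows "dense_in_interval {abs_trace A | A. A \<in> int_sym_conn_pd_mats} {2..}
       \<and> dense_in_interval {abs_trace_power 2 A | A. A \<in> int_sym_conn_pd_mats} {6..}"
proof -
  define D where "D k t i = (if i < k then real t else 2)" for k t i :: nat
  have mem: "path_mat n (D k t) \<in> int_sym_conn_pd_mats" if "n > 0" "t \<ge> 2" for n k t
    using that by (intro path_mat_in_int_sym_conn_pd_mats) (auto simp: D_def)
  have tr: "abs_trace (path_mat n (D k t)) = 2 + real k / real n * (real t - 2) - 0 / real n"
    if "n > 0" "k \<le> n" for n k t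
    using that by (simp add: abs_trace_path_mat D_def sum_two_valued field_simps)
  have tr2: "abs_trace_power 2 (path_mat n (D k t))
      = 6 + real k / real n * ((real t)\<^sup>2 - 4) - 2 / real n"
    if "n > 0" "k \<le> n" for n k t
  proof -
    have "(\<Sum>i<n. (D k t i)\<^sup>2) = (\<Sum>i<n. if i < k then (real t)\<^sup>2 else 4)"
      by (rule sum.cong) (auto simp: D_def)
    also have "\<dots> = real n * 4 + real k * ((real t)\<^sup>2 - 4)"
      by (rule sum_two_valued) (rule that)
    finally have squares: "(\<Sum>i<n. (D k t i)\<^sup>2) = real n * 4 + real k * ((real t)\<^sup>2 - 4)" .
    show ?thesis
      unfolding abs_trace_power_2_path_mat[OF that(1)] squares using that by (simp add: field_simps)
  qed
  have large: "\<exists>t::nat. t > 2 \<and> x \<le> real t" for x :: real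
  proof -
    obtain t :: nat where "x \<le> real t" using real_arch_simple by blast
    then show ?thesis by (intro exI[of _ "t + 3"]) auto
  qed
  have "x \<in> closure {abs_trace A | A. A \<in> int_sym_conn_pd_mats}" if "x \<ge> 2" for x
  proof -
    obtain t :: nat where t: "t > 2" "x \<le> real t" using large by blast
    show ?thesis
    proof (rule mem_closure_if_contains_fractions)
      fix n k :: nat assume nk: "n > 0" "k \<le> n"
      show "2 + real k / real n * (real t - 2) - 0 / real n
          \<in> {abs_trace A | A. A \<in> int_sym_conn_pd_mats}"
        unfolding tr[OF nk, symmetric] using mem[OF nk(1)] t by force
    qed (use t that in auto)
  qed
  moreover have "x \<in> closure {abs_trace_power 2 A | A. A \<in> int_sym_conn_pd_mats}"
    if "x \<ge> 6" for x
  proof -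
    obtain t :: nat where t: "t > 2" "x \<le> real t" using large by blast
    \<comment> \<open>A bound by \<open>t\<close> is more than enough, since the accumulation points reach \<open>t\<^sup>2 + 2\<close>.\<close>
    have sq: "2 * real t < (real t)\<^sup>2" using t by (simp add: power2_eq_square)
    show ?thesis
    proof (rule mem_closure_if_contains_fractions)
      fix n k :: nat assume nk: "n > 0" "k \<le> n"
      show "6 + real k / real n * ((real t)\<^sup>2 - 4) - 2 / real n
          \<in> {abs_trace_power 2 A | A. A \<in> int_sym_conn_pd_mats}"
        unfolding tr2[OF nk, symmetric] using mem[OF nk(1)] t by force
    next
      show "x \<le> 6 + ((real t)\<^sup>2 - 4)" and "(real t)\<^sup>2 - 4 > 0" using sq t by linarith+
    qed (rule that)
  qed
  ultimately show ?thesis by (auto simp: dense_in_interval_def)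
qed

end
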